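(* Let $G$ be a strongly topological gyrogroup and let $H$ be a closed first-countable and separable strong subgyrogroup of $G$. If the quotient space $G/H$ has a star-countable $cs$-network, then $G$ also has a star-countable $cs$-network.
   Context: All topological spaces are assumed Hausdorff. A gyrogroup is a nonempty set $G$ with a binary operation $\oplus$ such that: (G1) there is a unique $0\in G$ with $0\oplus a=a=a\oplus 0$ for all $a$; (G2) each $x\in G$ has a unique inverse $\ominus x$ with $\ominus x\oplus x=0=x\oplus(\ominus x)$; (G3) for all $x,y\in G$ there is an automorphism $\mathrm{gyr}[x,y]$ of $(G,\oplus)$ with $x\oplus(y\oplus z)=(x\oplus y)\oplus\mathrm{gyr}[x,y](z)$ for all $z\in G$; (G4) $\mathrm{gyr}[x\oplus y,y]=\mathrm{gyr}[x,y]$ for all $x,y\in G$. A topological gyrogroup is a gyrogroup with a topology making $\oplus:G\times G\to G$ jointly continuous and $x\mapsto\ominus x$ continuous. It is a strongly topological gyrogroup if there is a neighborhood base $\mathscr U$ of $0$ with $\mathrm{gyr}[x,y](U)=U$ for all $U\in\mathscr U$ and $x,y\in G$. A subgyrogroup is a nonempty subset $H\subseteq G$ that is a gyrogroup under the inherited operation and such that $\mathrm{gyr}[a,b]$ restricts to an automorphism of $H$ for all $a,b\in H$. It is a strong subgyrogroup if $\mathrm{gyr}[x,y](H)=H$ for all $x,y\in G$. For such $H$ the left cosets $a\oplus H$ ($a\in G$) partition $G$; $G/H=\{a\oplus H:a\in G\}$ carries the quotient topology induced by $\pi:G\to G/H$, $\pi(a)=a\oplus H$. Subgyrogroups carry the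 subspace topology. A family $\mathcal P$ of subsets of a space $X$ is a $cs$-network for $X$ if for every $x\in X$, every sequence $L$ converging to $x$ and every neighborhood $U$ of $x$ there is $P\in\mathcal P$ with $x\in P\subseteq U$ and $L$ eventually in $P$. A family $\mathcal P$ of sets is star-countable if each $P\in\mathcal P$ meets at most countably many members of $\mathcal P$. *)

theory Defs
  imports "HOL-Analysis.Analysis"
begin

section \<open>Gyrogroups\<close>

definition gyro_aut :: "'a set \<Rightarrow> ('a \<Rightarrow> 'a \<Rightarrow> 'a) \<Rightarrow> ('a \<Rightarrow> 'a) \<Rightarrow> bool" where
  "gyro_aut G op f \<longleftrightarrow>
     bij_betw f G G \<and> (\<forall>a\<in>G. \<forall>b\<in>G. f (op a b) = op (f a) (f b))"

text \<open>The identity, the inversion and the gyrations are parameters; the axioms determine them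
  uniquely on the carrier. Their values outside the carrier are irrelevant, so the last axiom
  states equality of gyrations on the carrier only.\<close>

locale gyrogroup =
  fixes G :: "'a set"
    and gyroplus :: "'a \<Rightarrow> 'a \<Rightarrow> 'a" (infixl \<open>\<oplus>\<^sub>g\<close> 65)
    and zero :: 'a
    and gyrominus :: "'a \<Rightarrow> 'a"
    and gyr :: "'a \<Rightarrow> 'a \<Rightarrow> 'a \<Rightarrow> 'a"
  assumes plus_closed: "\<lbrakk>x \<in> G; y \<in> G\<rbrakk> \<Longrightarrow> x \<oplus>\<^sub>g y \<in> G"
    and zero_closed: "zero \<in> G"
    and zero_plus: "a \<in> G \<Longrightarrow> zero \<oplus>\<^sub>g a = a"
    and plus_zero: "a \<in> G \<Longrightarrow> a \<oplus>\<^sub>g zero = a"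
    and zero_unique: "\<lbrakk>e \<in> G; \<forall>a\<in>G. e \<oplus>\<^sub>g a = a \<and> a \<oplus>\<^sub>g e = a\<rbrakk> \<Longrightarrow> e = zero"
    and minus_closed: "x \<in> G \<Longrightarrow> gyrominus x \<in> G"
    and minus_plus: "x \<in> G \<Longrightarrow> gyrominus x \<oplus>\<^sub>g x = zero"
    and plus_minus: "x \<in> G \<Longrightarrow> x \<oplus>\<^sub>g gyrominus x = zero"
    and minus_unique:
      "\<lbrakk>x \<in> G; y \<in> G; y \<oplus>\<^sub>g x = zero; x \<oplus>\<^sub>g y = zero\<rbrakk> \<Longrightarrow> y = gyrominus x"
    and gyr_aut: "\<lbrakk>x \<in> G; y \<in> G\<rbrakk> \<Longrightarrow> gyro_aut G (\<oplus>\<^sub>g) (gyr x y)"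
    and gyr_assoc:
      "\<lbrakk>x \<in> G; y \<in> G; z \<in> G\<rbrakk> \<Longrightarrow> x \<oplus>\<^sub>g (y \<oplus>\<^sub>g z) = (x \<oplus>\<^sub>g y) \<oplus>\<^sub>g gyr x y z"
    and gyr_left_loop:
      "\<lbrakk>x \<in> G; y \<in> G; z \<in> G\<rbrakk> \<Longrightarrow> gyr (x \<oplus>\<^sub>g y) y z = gyr x y z"
begin

definition subgyrogroup :: "'a set \<Rightarrow> bool" where
  "subgyrogroup H \<longleftrightarrow>
     H \<noteq> {} \<and> H \<subseteq> G \<and>
     (\<exists>zero' minus' gyr'. gyrogroup H (\<oplus>\<^sub>g) zero' minus' gyr') \<and>
     (\<forall>a\<in>H. \<forall>b\<in>H. gyro_aut H (\<oplus>\<^sub>g) (gyr a b))"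

definition strong_subgyrogroup :: "'a set \<Rightarrow> bool" where
  "strong_subgyrogroup H \<longleftrightarrow>
     subgyrogroup H \<and> (\<forall>x\<in>G. \<forall>y\<in>G. gyr x y ` H = H)"

definition left_coset :: "'a set \<Rightarrow> 'a \<Rightarrow> 'a set" where
  "left_coset H a = (\<lambda>h. a \<oplus>\<^sub>g h) ` H"

end

section \<open>Neighbourhoods, networks and quotients\<close>

definition nbhd_of :: "'a topology \<Rightarrow> 'a \<Rightarrow> 'a set \<Rightarrow> bool" where
  "nbhd_of X x U \<longleftrightarrow> U \<subseteq> topspace X \<and> (\<exists>V. openin X V \<and> x \<in> V \<and> V \<subseteq> U)"

definition nbhd_base_of :: "'a topology \<Rightarrow> 'a \<Rightarrow> 'a set set \<Rightarrow> bool" where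
  "nbhd_base_of X x \<U> \<longleftrightarrow>
     (\<forall>U\<in>\<U>. nbhd_of X x U) \<and> (\<forall>W. nbhd_of X x W \<longrightarrow> (\<exists>U\<in>\<U>. U \<subseteq> W))"

definition cs_network :: "'a topology \<Rightarrow> 'a set set \<Rightarrow> bool" where
  "cs_network X \<P> \<longleftrightarrow>
     (\<forall>P\<in>\<P>. P \<subseteq> topspace X) \<and>
     (\<forall>x\<in>topspace X. \<forall>L U.
        range L \<subseteq> topspace X \<and> limitin X L x sequentially \<and> nbhd_of X x U \<longrightarrow>
        (\<exists>P\<in>\<P>. x \<in> P \<and> P \<subseteq> U \<and> (\<forall>\<^sub>F n in sequentially. L n \<in> P)))"

definition star_countable :: "'a set set \<Rightarrow> bool" where
  "star_countable \<P> \<longleftrightarrow> (\<forall>P\<in>\<P>. countable {Q \<in> \<P>. P \<inter> Q \<noteq> {}})"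

definition quotient_topology :: "'a topology \<Rightarrow> ('a \<Rightarrow> 'b) \<Rightarrow> 'b topology" where
  "quotient_topology X f =
     topology (\<lambda>S. S \<subseteq> f ` topspace X \<and> openin X {x \<in> topspace X. f x \<in> S})"

lemma openin_quotient_topology:
  "openin (quotient_topology X f) S \<longleftrightarrow>
     S \<subseteq> f ` topspace X \<and> openin X {x \<in> topspace X. f x \<in> S}"
proof -
  have "istopology (\<lambda>S. S \<subseteq> f ` topspace X \<and> openin X {x \<in> topspace X. f x \<in> S})"
    unfolding istopology_def
  proof (intro conjI allI impI)
    fix S T
    assume S: "S \<subseteq> f ` topspace X \<and> openin X {x \<in> topspace X. f x \<in> S}"
      and T: "T \<subseteq> f ` topspace X \<and> openin X {x \<in> topspace X. f x \<in> T}"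
    have "{x \<in> topspace X. f x \<in> S \<inter> T}
        = {x \<in> topspace X. f x \<in> S} \<inter> {x \<in> topspace X. f x \<in> T}"
      by auto
    then show "openin X {x \<in> topspace X. f x \<in> S \<inter> T}"
      using S T by (simp only: openin_Int)
    show "S \<inter> T \<subseteq> f ` topspace X"
      using S by blast
  next
    fix \<K>
    assume K: "\<forall>S\<in>\<K>. S \<subseteq> f ` topspace X \<and> openin X {x \<in> topspace X. f x \<in> S}"
    have "{x \<in> topspace X. f x \<in> \<Union>\<K>} = (\<Union>S\<in>\<K>. {x \<in> topspace X. f x \<in> S})"
      by auto
    then show "openin X {x \<in> topspace X. f x \<in> \<Union>\<K>}"
      using K by auto
    show "\<Union>\<K> \<subseteq> f ` topspace X"
      using K by blast
  qed
  then show ?thesis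
    by (simp add: quotient_topology_def)
qed

lemma topspace_quotient_topology: "topspace (quotient_topology X f) = f ` topspace X"
proof
  show "topspace (quotient_topology X f) \<subseteq> f ` topspace X"
    using openin_quotient_topology openin_topspace by metis
  have "{x \<in> topspace X. f x \<in> f ` topspace X} = topspace X"
    by auto
  then have "openin (quotient_topology X f) (f ` topspace X)"
    by (simp add: openin_quotient_topology)
  then show "f ` topspace X \<subseteq> topspace (quotient_topology X f)"
    by (rule openin_subset)
qed

lemma quotient_map_quotient_topology: "quotient_map X (quotient_topology X f) f"
  by (auto simp: quotient_map_def topspace_quotient_topology openin_quotient_topology)

section \<open>Topological gyrogroups\<close>

locale topological_gyrogroup =
  gyrogroup "topspace X" gyroplus zero gyrominus gyr
  for X :: "'a topology"
    and gyroplus :: "'a \<Rightarrow> 'a \<Rightarrow> 'a" (infixl \<open>\<oplus>\<^sub>g\<close> 65)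
    and zero gyrominus gyr +
  assumes Hausdorff: "Hausdorff_space X"
    and continuous_plus: "continuous_map (prod_topology X X) X (\<lambda>(x, y). x \<oplus>\<^sub>g y)"
    and continuous_minus: "continuous_map X X gyrominus"
begin

definition coset_space :: "'a set \<Rightarrow> 'a set topology" where
  "coset_space H = quotient_topology X (left_coset H)"

end

locale strongly_topological_gyrogroup = topological_gyrogroup +
  assumes gyr_invariant_base:
    "\<exists>\<U>. nbhd_base_of X zero \<U> \<and>
       (\<forall>U\<in>\<U>. \<forall>x\<in>topspace X. \<forall>y\<in>topspace X. gyr x y ` U = U)"

end

theory Submission
  imports Defs
begin

text \<open>Let \<open>P\<close> run through a star-countable cs-network of \<open>G/H\<close>. Each \<open>P\<close> has a countable network,
  so its preimage, being the union of translates of the separable \<open>H\<close> over \<open>P\<close>, is separable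
  because the coset map is open; let \<open>b\<close> run through a countable dense set. Choose countably many
  gyration-invariant neighbourhoods \<open>U\<^sub>n\<close> of \<open>0\<close> such that the elements of
  \<open>\<ominus>U\<^sub>n \<oplus> (U\<^sub>n \<oplus> U\<^sub>n)\<close> lying in \<open>H\<close> lie in any prescribed neighbourhood of \<open>0\<close> for some \<open>n\<close>.
  The sets \<open>(b \<oplus> U\<^sub>n) \<inter> \<pi>\<inverse>(P)\<close> form the required network: if such a set contains \<open>x\<close> and \<open>b\<close> is
  close to \<open>x\<close>, its elements are both \<open>x \<oplus> (t \<oplus> v)\<close> with \<open>t, v \<in> U\<^sub>n\<close> and \<open>x \<oplus> (w \<oplus> h)\<close> with \<open>w\<close>
  small and \<open>h \<in> H\<close>, so that \<open>h = \<ominus>w \<oplus> (t \<oplus> v)\<close> is small.\<close>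

section \<open>Gyrogroup algebra\<close>

context gyrogroup
begin

section \<open>Gyrations and left cancellation\<close>

lemma gyr_closed: "\<lbrakk>x \<in> G; y \<in> G; z \<in> G\<rbrakk> \<Longrightarrow> gyr x y z \<in> G"
  using gyr_aut[of x y] by (auto simp: gyro_aut_def bij_betw_def)

lemma gyr_inject: "\<lbrakk>x \<in> G; y \<in> G; a \<in> G; b \<in> G; gyr x y a = gyr x y b\<rbrakk> \<Longrightarrow> a = b"
  using gyr_aut[of x y] by (auto simp: gyro_aut_def bij_betw_def inj_on_def)

lemma minus_plus_gyr:
  assumes "a \<in> G" "b \<in> G"
  shows "gyrominus a \<oplus>\<^sub>g (a \<oplus>\<^sub>g b) = gyr (gyrominus a) a b"
  using assms gyr_assoc[of "gyrominus a" a b]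
  by (simp add: minus_closed minus_plus zero_plus gyr_closed)

text \<open>At this stage \<open>gyr (gyrominus a) a\<close> is not known to be the identity; its
  injectivity alone gives cancellation after \<open>gyrominus a\<close> is added on the
  left.\<close>

lemma plus_left_cancel:
  assumes "a \<in> G" "b \<in> G" "c \<in> G" "a \<oplus>\<^sub>g b = a \<oplus>\<^sub>g c"
  shows "b = c"
proof (rule gyr_inject)
  show "gyr (gyrominus a) a b = gyr (gyrominus a) a c"
    unfolding minus_plus_gyr[OF assms(1,2), symmetric] minus_plus_gyr[OF assms(1,3), symmetric]
    by (simp only: assms(4))
qed (use assms minus_closed in auto)

text \<open>Associativity with first summand \<open>zero\<close> compares \<open>a\<close> plus
  \<open>b\<close> with \<open>a\<close> plus the gyrated \<open>b\<close>, and \<open>a\<close>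
  cancels.\<close>

lemma gyr_zero_left:
  assumes "a \<in> G" "b \<in> G"
  shows "gyr zero a b = b"
proof -
  have "a \<oplus>\<^sub>g gyr zero a b = a \<oplus>\<^sub>g b"
    using assms gyr_assoc[of zero a b] by (simp add: zero_closed zero_plus plus_closed)
  then show ?thesis
    by (rule plus_left_cancel[rotated 3]) (use assms in \<open>simp_all add: gyr_closed zero_closed\<close>)
qed

text \<open>The left loop property replaces the gyration left over by associativity with one whose
  first argument is \<open>zero\<close>, which is trivial.\<close>

lemma minus_plus_cancel:
  assumes "a \<in> G" "b \<in> G"
  shows "gyrominus a \<oplus>\<^sub>g (a \<oplus>\<^sub>g b) = b"
proof -
  have "gyr (gyrominus a) a b = gyr zero a b"
    using assms gyr_left_loop[of "gyrominus a" a b] by (simp add: minus_closed minus_plus)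
  then show ?thesis
    using assms by (simp add: minus_plus_gyr gyr_zero_left)
qed

lemma minus_minus:
  assumes "a \<in> G"
  shows "gyrominus (gyrominus a) = a"
  using assms by (intro minus_unique[symmetric]) (simp_all add: minus_closed minus_plus plus_minus)

lemma plus_minus_cancel:
  assumes "a \<in> G" "b \<in> G"
  shows "a \<oplus>\<^sub>g (gyrominus a \<oplus>\<^sub>g b) = b"
  using minus_plus_cancel[of "gyrominus a" b] assms by (simp add: minus_closed minus_minus)

text \<open>A substitute for associativity: moving the brackets to the right changes
  \<open>s\<close> by the inverse of a gyration, which does not leave \<open>S\<close>. It serves
  both for \<open>H\<close> and for invariant neighbourhoods of \<open>zero\<close>.\<close>

lemma plus_assoc_gyr_invariant:
  assumes "x \<in> G" "y \<in> G" "S \<subseteq> G" "gyr x y ` S = S" "s \<in> S"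
  obtains s' where "s' \<in> S" "(x \<oplus>\<^sub>g y) \<oplus>\<^sub>g s = x \<oplus>\<^sub>g (y \<oplus>\<^sub>g s')"
proof -
  obtain s' where s': "s' \<in> S" "s = gyr x y s'"
    using assms by blast
  then show thesis
    using that[OF s'(1)] gyr_assoc[OF assms(1,2), of s'] assms(3) by auto
qed

section \<open>Strong subgyrogroups and their left cosets\<close>

context
  fixes H assumes H: "strong_subgyrogroup H"
begin

lemma strong_subgyrogroup_subset: "H \<subseteq> G"
  using H by (simp add: strong_subgyrogroup_def subgyrogroup_def)

lemma strong_subgyrogroup_gyr: "\<lbrakk>x \<in> G; y \<in> G\<rbrakk> \<Longrightarrow> gyr x y ` H = H"
  using H by (simp add: strong_subgyrogroup_def)

text \<open>As a gyrogroup \<open>H\<close> has its own identity and inversion. Left cancellation in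
  \<open>G\<close> and uniqueness of inverses identify them with those of \<open>G\<close>.\<close>

lemma strong_subgyrogroup_closed:
  shows strong_subgyrogroup_plus: "\<lbrakk>a \<in> H; b \<in> H\<rbrakk> \<Longrightarrow> a \<oplus>\<^sub>g b \<in> H"
    and strong_subgyrogroup_zero: "zero \<in> H"
    and strong_subgyrogroup_minus: "a \<in> H \<Longrightarrow> gyrominus a \<in> H"
proof -
  obtain z m g where "gyrogroup H (\<oplus>\<^sub>g) z m g"
    using H unfolding strong_subgyrogroup_def subgyrogroup_def by blast
  then interpret sub: gyrogroup H "(\<oplus>\<^sub>g)" z m g .
  note subset = subsetD[OF strong_subgyrogroup_subset]
  show "\<lbrakk>a \<in> H; b \<in> H\<rbrakk> \<Longrightarrow> a \<oplus>\<^sub>g b \<in> H"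
    by (rule sub.plus_closed)
  have "z \<oplus>\<^sub>g z = z \<oplus>\<^sub>g zero"
    using sub.zero_plus[OF sub.zero_closed] plus_zero[OF subset[OF sub.zero_closed]] by simp
  then have z: "z = zero"
    by (rule plus_left_cancel[rotated 3]) (simp_all add: subset sub.zero_closed zero_closed)
  then show "zero \<in> H"
    using sub.zero_closed by simp
  assume a: "a \<in> H"
  then have "m a = gyrominus a"
    using minus_unique[of a "m a"] subset sub.minus_closed sub.minus_plus sub.plus_minus z by auto
  then show "gyrominus a \<in> H"
    using a sub.minus_closed by metis
qed

text \<open>Rebracketing changes the summand from \<open>H\<close> only by a gyration, and
  \<open>H\<close> is invariant under gyrations and closed under sums and inverses.\<close>

lemma left_coset_absorb:
  assumes a: "a \<in> G" and h: "h \<in> H"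
  shows "left_coset H (a \<oplus>\<^sub>g h) = left_coset H a"
proof
  note subset = subsetD[OF strong_subgyrogroup_subset]
  show "left_coset H (a \<oplus>\<^sub>g h) \<subseteq> left_coset H a"
  proof
    fix y assume "y \<in> left_coset H (a \<oplus>\<^sub>g h)"
    then obtain k where k: "k \<in> H" "y = (a \<oplus>\<^sub>g h) \<oplus>\<^sub>g k"
      unfolding left_coset_def by blast
    obtain k' where "k' \<in> H" "y = a \<oplus>\<^sub>g (h \<oplus>\<^sub>g k')"
      using plus_assoc_gyr_invariant[OF a subset[OF h] strong_subgyrogroup_subset
          strong_subgyrogroup_gyr[OF a subset[OF h]] k(1)] k(2) by metis
    then show "y \<in> left_coset H a"
      using h strong_subgyrogroup_plus unfolding left_coset_def by blast
  qed
  show "left_coset H a \<subseteq> left_coset H (a \<oplus>\<^sub>g h)"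
  proof
    fix y assume "y \<in> left_coset H a"
    then obtain k where k: "k \<in> H" "y = a \<oplus>\<^sub>g k"
      unfolding left_coset_def by blast
    define k' where "k' = gyrominus h \<oplus>\<^sub>g k"
    have k': "k' \<in> H"
      using k h strong_subgyrogroup_plus strong_subgyrogroup_minus by (simp add: k'_def)
    have "y = a \<oplus>\<^sub>g (h \<oplus>\<^sub>g k')"
      using k h subset by (simp add: k'_def plus_minus_cancel)
    also have "\<dots> = (a \<oplus>\<^sub>g h) \<oplus>\<^sub>g gyr a h k'"
      using a h k' subset by (intro gyr_assoc) auto
    finally show "y \<in> left_coset H (a \<oplus>\<^sub>g h)"
      using strong_subgyrogroup_gyr[OF a subset[OF h]] k' unfolding left_coset_def by blast
  qed
qed

lemma left_coset_eqD:
  assumes "a \<in> G" "b \<in> G" "left_coset H b = left_coset H a"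
  obtains h where "h \<in> H" "b = a \<oplus>\<^sub>g h"
proof -
  have "b \<in> left_coset H b"
    using strong_subgyrogroup_zero plus_zero[OF assms(2)] unfolding left_coset_def by force
  then show thesis
    using that assms(3) unfolding left_coset_def by auto
qed

end

end

section \<open>Topological gyrogroups and their coset spaces\<close>

context topological_gyrogroup
begin

section \<open>Continuity of translations and small neighbourhoods of the identity\<close>

lemma continuous_map_plus:
  assumes "continuous_map Y X f" "continuous_map Y X g"
  shows "continuous_map Y X (\<lambda>z. f z \<oplus>\<^sub>g g z)"
  using continuous_map_compose[OF continuous_map_pairedI[OF assms] continuous_plus]
  by (simp add: o_def)

lemma continuous_map_minus:
  assumes "continuous_map Y X f"
  shows "continuous_map Y X (\<lambda>z. gyrominus (f z))"
  using continuous_map_compose[OF assms continuous_minus] by (simp add: o_def)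

lemma openin_left_translation:
  assumes "a \<in> topspace X" "openin X U"
  shows "openin X {y \<in> topspace X. a \<oplus>\<^sub>g y \<in> U}"
  using assms by (intro openin_continuous_map_preimage[where Y = X] continuous_map_plus) simp_all

lemma openin_right_translation:
  assumes "a \<in> topspace X" "openin X U"
  shows "openin X {y \<in> topspace X. y \<oplus>\<^sub>g a \<in> U}"
  using assms by (intro openin_continuous_map_preimage[where Y = X] continuous_map_plus) simp_all

lemma openin_minus_plus:
  assumes "a \<in> topspace X" "openin X U"
  shows "openin X {y \<in> topspace X. gyrominus y \<oplus>\<^sub>g a \<in> U}"
  using assms
  by (intro openin_continuous_map_preimage[where Y = X] continuous_map_plus continuous_map_minus)
    simp_all

lemma plus_small:
  assumes "openin X W" "zero \<in> W"
  obtains V where "openin X V" "zero \<in> V" "\<And>u v. \<lbrakk>u \<in> V; v \<in> V\<rbrakk> \<Longrightarrow> u \<oplus>\<^sub>g v \<in> W"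
proof -
  let ?S = "{p \<in> topspace (prod_topology X X). (\<lambda>(x, y). x \<oplus>\<^sub>g y) p \<in> W}"
  have "openin (prod_topology X X) ?S"
    using continuous_plus assms(1) by (rule openin_continuous_map_preimage)
  moreover have "(zero, zero) \<in> ?S"
    using assms zero_closed by (simp add: zero_plus)
  ultimately obtain A B where AB: "openin X A" "openin X B" "zero \<in> A" "zero \<in> B" "A \<times> B \<subseteq> ?S"
    unfolding openin_prod_topology_alt by meson
  show thesis
  proof (rule that[of "A \<inter> B"])
    fix u v assume "u \<in> A \<inter> B" "v \<in> A \<inter> B"
    then have "(u, v) \<in> ?S" using AB(5) by blast
    then show "u \<oplus>\<^sub>g v \<in> W" by simp
  qed (use AB in auto)
qed

text \<open>Continuity of addition at \<open>zero\<close> is used twice, once for the outer sum and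
  once for \<open>t\<close> plus \<open>v\<close>; continuity of inversion takes care of
  \<open>w\<close>.\<close>

lemma minus_plus_plus_small:
  assumes "openin X W" "zero \<in> W"
  obtains V where "openin X V" "zero \<in> V"
    "\<And>w t v. \<lbrakk>w \<in> V; t \<in> V; v \<in> V\<rbrakk> \<Longrightarrow> gyrominus w \<oplus>\<^sub>g (t \<oplus>\<^sub>g v) \<in> W"
proof -
  obtain A where A: "openin X A" "zero \<in> A" "\<And>u v. \<lbrakk>u \<in> A; v \<in> A\<rbrakk> \<Longrightarrow> u \<oplus>\<^sub>g v \<in> W"
    using plus_small[OF assms] by blast
  obtain B where B: "openin X B" "zero \<in> B" "\<And>u v. \<lbrakk>u \<in> B; v \<in> B\<rbrakk> \<Longrightarrow> u \<oplus>\<^sub>g v \<in> A"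
    using plus_small[OF A(1,2)] by blast
  let ?C = "{y \<in> topspace X. gyrominus y \<in> A}"
  have "gyrominus zero = zero"
    by (rule minus_unique[symmetric]) (simp_all add: zero_closed zero_plus)
  then have "zero \<in> ?C"
    using A(2) zero_closed by simp
  moreover have "openin X ?C"
    using continuous_minus A(1) by (rule openin_continuous_map_preimage)
  ultimately show thesis
    using A B by (intro that[of "B \<inter> ?C"]) auto
qed

section \<open>The topology of the coset space\<close>

lemma topspace_coset_space: "topspace (coset_space H) = left_coset H ` topspace X"
  by (simp add: coset_space_def topspace_quotient_topology)

lemma continuous_map_left_coset: "continuous_map X (coset_space H) (left_coset H)"
  unfolding coset_space_def
  by (rule quotient_imp_continuous_map[OF quotient_map_quotient_topology])

context
  fixes H assumes H: "strong_subgyrogroup H"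
begin

text \<open>The saturation of \<open>U\<close> is a union of preimages of \<open>U\<close> under
  right translations by elements of \<open>H\<close>. Continuity of these translations suffices for
  it to be open.\<close>

lemma open_map_left_coset: "open_map X (coset_space H) (left_coset H)"
  unfolding open_map_def
proof (intro allI impI)
  fix U assume U: "openin X U"
  note UX = openin_subset[OF U]
  note HX = strong_subgyrogroup_subset[OF H]
  have "{y \<in> topspace X. left_coset H y \<in> left_coset H ` U}
      = (\<Union>h\<in>H. {y \<in> topspace X. y \<oplus>\<^sub>g h \<in> U})" (is "?L = ?R")
  proof
    show "?L \<subseteq> ?R"
    proof
      fix y assume "y \<in> ?L"
      then obtain u where y: "y \<in> topspace X" and u: "u \<in> U" "left_coset H u = left_coset H y"
        by auto
      obtain h where "h \<in> H" "u = y \<oplus>\<^sub>g h"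
        using left_coset_eqD[OF H y _ u(2)] u(1) UX by blast
      then show "y \<in> ?R"
        using y u(1) by blast
    qed
    show "?R \<subseteq> ?L"
    proof
      fix y assume "y \<in> ?R"
      then obtain h where y: "y \<in> topspace X" and h: "h \<in> H" "y \<oplus>\<^sub>g h \<in> U"
        by blast
      then show "y \<in> ?L"
        using left_coset_absorb[OF H y h(1)] by blast
    qed
  qed
  moreover have "openin X ?R"
    using HX U by (blast intro: openin_right_translation)
  ultimately show "openin (coset_space H) (left_coset H ` U)"
    using UX by (auto simp: coset_space_def openin_quotient_topology)
qed

lemma nbhd_of_left_coset_image:
  assumes "openin X U" "x \<in> U"
  shows "nbhd_of (coset_space H) (left_coset H x) (left_coset H ` U)"
proof -
  have "openin (coset_space H) (left_coset H ` U)"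
    using open_map_left_coset assms(1) by (simp add: open_map_def)
  with assms(2) openin_subset[OF this] show ?thesis
    unfolding nbhd_of_def by blast
qed

text \<open>The set \<open>B\<close> meets every open set that meets the preimage of
  \<open>P\<close>, but its points may lie outside this preimage: they are translates of a dense
  subset of \<open>H\<close> by one representative for each \<open>Q\<close> meeting
  \<open>P\<close>.\<close>

lemma separable_preimage_of_network_element:
  assumes sep: "separable_space (subtopology X H)"
    and cs: "cs_network (coset_space H) \<P>"
    and P: "countable {Q \<in> \<P>. P \<inter> Q \<noteq> {}}"
  obtains B where "countable B" "B \<subseteq> topspace X"
    "\<And>U x. \<lbrakk>openin X U; x \<in> U; left_coset H x \<in> P\<rbrakk> \<Longrightarrow> \<exists>b\<in>B. b \<in> U"
proof -
  note HX = strong_subgyrogroup_subset[OF H]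
  obtain D where D: "countable D" "D \<subseteq> H"
    and dense: "\<And>T. \<lbrakk>openin (subtopology X H) T; T \<noteq> {}\<rbrakk> \<Longrightarrow> D \<inter> T \<noteq> {}"
    using sep unfolding separable_space_def dense_intersects_open by auto
  let ?Q = "{Q \<in> \<P>. P \<inter> Q \<noteq> {}}"
  have "\<exists>a. a \<in> topspace X \<and> left_coset H a \<in> Q" if "Q \<in> ?Q" for Q
  proof -
    have "Q \<subseteq> left_coset H ` topspace X"
      using cs that unfolding cs_network_def topspace_coset_space by blast
    then show ?thesis using that by blast
  qed
  then obtain a where a: "\<And>Q. Q \<in> ?Q \<Longrightarrow> a Q \<in> topspace X \<and> left_coset H (a Q) \<in> Q"
    by metis
  define B where "B = (\<Union>Q\<in>?Q. (\<oplus>\<^sub>g) (a Q) ` D)"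
  show thesis
  proof (rule that[of B])
    show "countable B"
      unfolding B_def using P D(1) by (intro countable_UN countable_image) auto
    show "B \<subseteq> topspace X"
      unfolding B_def using a D(2) HX by (blast intro: plus_closed)
    fix U x assume U: "openin X U" "x \<in> U" "left_coset H x \<in> P"
    have x: "x \<in> topspace X"
      using U openin_subset by blast
    have "nbhd_of (coset_space H) (left_coset H x) (left_coset H ` U)"
      using U(1,2) by (rule nbhd_of_left_coset_image)
    moreover have "left_coset H x \<in> topspace (coset_space H)"
      using x by (simp add: topspace_coset_space)
    \<comment> \<open>The constant sequence shows that a cs-network is in particular a
      network.\<close>
    ultimately obtain Q where Q: "Q \<in> \<P>" "left_coset H x \<in> Q" "Q \<subseteq> left_coset H ` U"
      using cs[unfolded cs_network_def, THEN conjunct2, rule_format,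
          of "left_coset H x" "\<lambda>_. left_coset H x" "left_coset H ` U"]
      by auto
    then have QQ: "Q \<in> ?Q"
      using U(3) by blast
    \<comment> \<open>The coset represented by \<open>a Q\<close> meets \<open>U\<close>, say in
      \<open>a Q\<close> plus \<open>h\<close>. Density then allows \<open>h\<close> to be replaced
      by some \<open>d\<close> in \<open>D\<close>.\<close>
    obtain u where u: "u \<in> U" "left_coset H u = left_coset H (a Q)"
      using a[OF QQ] Q(3) by auto
    obtain h where h: "h \<in> H" "u = a Q \<oplus>\<^sub>g h"
      using left_coset_eqD[OF H _ _ u(2)] a[OF QQ] u(1) U(1) openin_subset by blast
    let ?T = "{y \<in> topspace X. a Q \<oplus>\<^sub>g y \<in> U} \<inter> H"
    have "openin (subtopology X H) ?T"
      using openin_left_translation[OF _ U(1)] a[OF QQ] by (auto simp: openin_subtopology)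
    moreover have "h \<in> ?T"
      using h u(1) HX by auto
    ultimately obtain d where "d \<in> D" "a Q \<oplus>\<^sub>g d \<in> U"
      using dense by blast
    then show "\<exists>b\<in>B. b \<in> U"
      unfolding B_def using QQ by blast
  qed
qed

end

end

section \<open>Lifting the network\<close>

context strongly_topological_gyrogroup
begin

section \<open>Gyration-invariant neighbourhoods and the lifted network\<close>

lemma gyr_invariant_nbhd:
  assumes "openin X W" "zero \<in> W"
  obtains U where "nbhd_of X zero U" "U \<subseteq> W"
    "\<And>x y. \<lbrakk>x \<in> topspace X; y \<in> topspace X\<rbrakk> \<Longrightarrow> gyr x y ` U = U"
proof -
  have "nbhd_of X zero W"
    using assms openin_subset unfolding nbhd_of_def by blast
  moreover obtain \<U> where "nbhd_base_of X zero \<U>"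
    and gyr: "\<forall>U\<in>\<U>. \<forall>x\<in>topspace X. \<forall>y\<in>topspace X. gyr x y ` U = U"
    using gyr_invariant_base by blast
  ultimately obtain U where U: "U \<in> \<U>" "nbhd_of X zero U" "U \<subseteq> W"
    unfolding nbhd_base_of_def by meson
  show thesis
    using U(2,3) gyr[rule_format, OF U(1)] by (rule that)
qed

text \<open>First countability is available in \<open>H\<close> only, so smallness is demanded only
  of those combinations that fall into \<open>H\<close>. One invariant neighbourhood is chosen for
  each member of a countable base of \<open>H\<close> at \<open>zero\<close>.\<close>

lemma countable_small_trace_nbhds:
  assumes H: "zero \<in> H" and fc: "first_countable (subtopology X H)"
  obtains \<U> where "countable \<U>"
    "\<And>U. U \<in> \<U> \<Longrightarrow> nbhd_of X zero U"
    "\<And>U x y. \<lbrakk>U \<in> \<U>; x \<in> topspace X; y \<in> topspace X\<rbrakk> \<Longrightarrow> gyr x y ` U = U"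
    "\<And>W. \<lbrakk>openin X W; zero \<in> W\<rbrakk> \<Longrightarrow> \<exists>U\<in>\<U>. \<forall>w\<in>U. \<forall>t\<in>U. \<forall>v\<in>U.
       gyrominus w \<oplus>\<^sub>g (t \<oplus>\<^sub>g v) \<in> H \<longrightarrow> gyrominus w \<oplus>\<^sub>g (t \<oplus>\<^sub>g v) \<in> W"
proof -
  have "zero \<in> topspace (subtopology X H)"
    using H zero_closed by simp
  then obtain \<B> where B: "countable \<B>" "\<And>V. V \<in> \<B> \<Longrightarrow> openin (subtopology X H) V"
    "\<And>U. \<lbrakk>openin (subtopology X H) U; zero \<in> U\<rbrakk> \<Longrightarrow> \<exists>V\<in>\<B>. zero \<in> V \<and> V \<subseteq> U"
    using fc unfolding first_countable_def by meson
  \<comment> \<open>The family given by first countability may also contain sets that miss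
    \<open>zero\<close>.\<close>
  define \<C> where "\<C> = {V \<in> \<B>. zero \<in> V}"
  have "\<exists>U. nbhd_of X zero U \<and> (\<forall>x\<in>topspace X. \<forall>y\<in>topspace X. gyr x y ` U = U) \<and>
      (\<forall>w\<in>U. \<forall>t\<in>U. \<forall>v\<in>U. gyrominus w \<oplus>\<^sub>g (t \<oplus>\<^sub>g v) \<in> H \<longrightarrow> gyrominus w \<oplus>\<^sub>g (t \<oplus>\<^sub>g v) \<in> V)"
    if V: "V \<in> \<C>" for V
  proof -
    obtain O' where O': "openin X O'" "V = O' \<inter> H"
      using V B(2) unfolding \<C>_def openin_subtopology by blast
    have "zero \<in> O'"
      using V O'(2) unfolding \<C>_def by blast
    then obtain A where A: "openin X A" "zero \<in> A"
      "\<And>w t v. \<lbrakk>w \<in> A; t \<in> A; v \<in> A\<rbrakk> \<Longrightarrow> gyrominus w \<oplus>\<^sub>g (t \<oplus>\<^sub>g v) \<in> O'"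
      using minus_plus_plus_small[OF O'(1)] by blast
    obtain U where "nbhd_of X zero U" "U \<subseteq> A"
      "\<And>x y. \<lbrakk>x \<in> topspace X; y \<in> topspace X\<rbrakk> \<Longrightarrow> gyr x y ` U = U"
      using gyr_invariant_nbhd[OF A(1,2)] by blast
    then show ?thesis
      using A(3) O'(2) by (intro exI[of _ U]) blast
  qed
  then obtain U where U: "\<And>V. V \<in> \<C> \<Longrightarrow> nbhd_of X zero (U V)"
    "\<And>V. V \<in> \<C> \<Longrightarrow> \<forall>x\<in>topspace X. \<forall>y\<in>topspace X. gyr x y ` U V = U V"
    "\<And>V. V \<in> \<C> \<Longrightarrow> \<forall>w\<in>U V. \<forall>t\<in>U V. \<forall>v\<in>U V.
       gyrominus w \<oplus>\<^sub>g (t \<oplus>\<^sub>g v) \<in> H \<longrightarrow> gyrominus w \<oplus>\<^sub>g (t \<oplus>\<^sub>g v) \<in> V"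
    by metis
  show thesis
  proof (rule that[of "U ` \<C>"])
    show "countable (U ` \<C>)"
      using B(1) unfolding \<C>_def by simp
    fix W assume W: "openin X W" "zero \<in> W"
    then obtain V where "V \<in> \<C>" "V \<subseteq> W"
      using B(3)[of "W \<inter> H"] H unfolding \<C>_def openin_subtopology by auto
    then show "\<exists>U\<in>U ` \<C>. \<forall>w\<in>U. \<forall>t\<in>U. \<forall>v\<in>U.
       gyrominus w \<oplus>\<^sub>g (t \<oplus>\<^sub>g v) \<in> H \<longrightarrow> gyrominus w \<oplus>\<^sub>g (t \<oplus>\<^sub>g v) \<in> W"
      using U(3) by (meson image_eqI subsetD)
  qed (use U in blast)+
qed

lemma star_countable_cs_network_lift:
  assumes H: "strong_subgyrogroup H"
    and fc: "first_countable (subtopology X H)"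
    and sep: "separable_space (subtopology X H)"
    and cs: "cs_network (coset_space H) \<P>"
    and star: "star_countable \<P>"
  shows "\<exists>\<R>. cs_network X \<R> \<and> star_countable \<R>"
proof -
  note HX = strong_subgyrogroup_subset[OF H]
  obtain \<U> where U_count: "countable \<U>"
    and U_nbhd: "\<And>U. U \<in> \<U> \<Longrightarrow> nbhd_of X zero U"
    and U_gyr: "\<And>U x y. \<lbrakk>U \<in> \<U>; x \<in> topspace X; y \<in> topspace X\<rbrakk> \<Longrightarrow> gyr x y ` U = U"
    and U_small: "\<And>W. \<lbrakk>openin X W; zero \<in> W\<rbrakk> \<Longrightarrow> \<exists>U\<in>\<U>. \<forall>w\<in>U. \<forall>t\<in>U. \<forall>v\<in>U.
       gyrominus w \<oplus>\<^sub>g (t \<oplus>\<^sub>g v) \<in> H \<longrightarrow> gyrominus w \<oplus>\<^sub>g (t \<oplus>\<^sub>g v) \<in> W"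
    by (fact countable_small_trace_nbhds[OF strong_subgyrogroup_zero[OF H] fc])
  have "\<exists>B. countable B \<and> B \<subseteq> topspace X \<and>
      (\<forall>U x. openin X U \<and> x \<in> U \<and> left_coset H x \<in> P \<longrightarrow> (\<exists>b\<in>B. b \<in> U))" if "P \<in> \<P>" for P
  proof -
    have "countable {Q \<in> \<P>. P \<inter> Q \<noteq> {}}"
      using star that unfolding star_countable_def by blast
    then show ?thesis
      by (rule separable_preimage_of_network_element[OF H sep cs]) blast
  qed
  then obtain B where B_count: "\<And>P. P \<in> \<P> \<Longrightarrow> countable (B P)"
    and BX: "\<And>P. P \<in> \<P> \<Longrightarrow> B P \<subseteq> topspace X"
    and B_dense: "\<And>P U x. \<lbrakk>P \<in> \<P>; openin X U; x \<in> U; left_coset H x \<in> P\<rbrakk> \<Longrightarrow> \<exists>b\<in>B P. b \<in> U"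
    by metis
  \<comment> \<open>For \<open>b\<close> in \<open>B P\<close> and \<open>U\<close> in
    \<open>\<U>\<close> this is the left translate of \<open>U\<close> by \<open>b\<close>, cut down
    to the preimage of \<open>P\<close>.\<close>
  define N where "N P b U = {y \<in> topspace X. gyrominus b \<oplus>\<^sub>g y \<in> U \<and> left_coset H y \<in> P}" for P b U
  define F where "F P = (\<lambda>(b, U). N P b U) ` (B P \<times> \<U>)" for P
  have "star_countable (\<Union>P\<in>\<P>. F P)"
    unfolding star_countable_def
  proof
    fix R assume "R \<in> (\<Union>P\<in>\<P>. F P)"
    then obtain P b U where P: "P \<in> \<P>" "R = N P b U"
      unfolding F_def by auto
    \<comment> \<open>A common point of two such sets has its coset in both underlying members of
      \<open>\<P>\<close>, so these meet; each of them contributes only countably many sets.\<close>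
    have "{S \<in> \<Union>P\<in>\<P>. F P. R \<inter> S \<noteq> {}} \<subseteq> (\<Union>P'\<in>{Q \<in> \<P>. P \<inter> Q \<noteq> {}}. F P')"
      unfolding P F_def N_def by auto
    moreover have "countable \<dots>"
    proof (rule countable_UN)
      show "countable {Q \<in> \<P>. P \<inter> Q \<noteq> {}}"
        using star P unfolding star_countable_def by blast
      show "countable (F P')" if "P' \<in> {Q \<in> \<P>. P \<inter> Q \<noteq> {}}" for P'
        unfolding F_def using that B_count U_count by (intro countable_image countable_SIGMA) auto
    qed
    ultimately show "countable {S \<in> \<Union>P\<in>\<P>. F P. R \<inter> S \<noteq> {}}"
      by (rule countable_subset)
  qed
  moreover have "cs_network X (\<Union>P\<in>\<P>. F P)"
    unfolding cs_network_def
  proof (intro conjI ballI allI impI)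
    fix R assume "R \<in> (\<Union>P\<in>\<P>. F P)"
    then show "R \<subseteq> topspace X"
      unfolding F_def N_def by auto
  next
    fix x L S
    assume x: "x \<in> topspace X"
      and "range L \<subseteq> topspace X \<and> limitin X L x sequentially \<and> nbhd_of X x S"
    then have LX: "range L \<subseteq> topspace X" and Lx: "limitin X L x sequentially"
      and S: "nbhd_of X x S"
      by auto
    obtain S0 where S0: "openin X S0" "x \<in> S0" "S0 \<subseteq> S"
      using S unfolding nbhd_of_def by blast
    \<comment> \<open>\<open>S0\<close> is moved to \<open>zero\<close> and then halved:
      \<open>W1\<close> must contain both summands of \<open>w\<close> plus \<open>h\<close>
      below.\<close>
    define W where "W = {y \<in> topspace X. x \<oplus>\<^sub>g y \<in> S0}"
    have W: "openin X W" "zero \<in> W"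
      using openin_left_translation[OF x S0(1)] S0(2) x zero_closed
      by (auto simp: W_def plus_zero)
    obtain W1 where W1: "openin X W1" "zero \<in> W1" "\<And>u v. \<lbrakk>u \<in> W1; v \<in> W1\<rbrakk> \<Longrightarrow> u \<oplus>\<^sub>g v \<in> W"
      using plus_small[OF W] by blast
    obtain U where U: "U \<in> \<U>" and U_W1: "\<And>w t v. \<lbrakk>w \<in> U; t \<in> U; v \<in> U;
       gyrominus w \<oplus>\<^sub>g (t \<oplus>\<^sub>g v) \<in> H\<rbrakk> \<Longrightarrow> gyrominus w \<oplus>\<^sub>g (t \<oplus>\<^sub>g v) \<in> W1"
      using U_small[OF W1(1,2)] by blast
    \<comment> \<open>\<open>U\<close> need not be open; its open part \<open>U0\<close> is used
      wherever an open condition is required.\<close>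
    obtain U0 where U0: "openin X U0" "zero \<in> U0" "U0 \<subseteq> U" and UX: "U \<subseteq> topspace X"
      using U_nbhd[OF U] unfolding nbhd_of_def by blast
    \<comment> \<open>The points of \<open>A\<close> differ from \<open>x\<close> by an element of
      both \<open>U0\<close> and \<open>W1\<close>: the former makes \<open>U_W1\<close> applicable,
      the latter makes \<open>w\<close> a small summand.\<close>
    define A where "A = {y \<in> topspace X. gyrominus x \<oplus>\<^sub>g y \<in> U0 \<inter> W1}"
    have A: "openin X A" "x \<in> A"
      using openin_left_translation[OF minus_closed[OF x] openin_Int[OF U0(1) W1(1)]] x U0 W1
      by (auto simp: A_def minus_plus)
    have "limitin (coset_space H) (left_coset H \<circ> L) (left_coset H x) sequentially"
      using continuous_map_left_coset Lx by (rule continuous_map_limit)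
    moreover have "nbhd_of (coset_space H) (left_coset H x) (left_coset H ` A)"
      using A by (rule nbhd_of_left_coset_image[OF H])
    moreover have "left_coset H x \<in> topspace (coset_space H)"
      using x by (simp add: topspace_coset_space)
    moreover have "range (left_coset H \<circ> L) \<subseteq> topspace (coset_space H)"
      using LX unfolding topspace_coset_space by (simp add: image_subset_iff)
    ultimately obtain P where P: "P \<in> \<P>" "left_coset H x \<in> P" "P \<subseteq> left_coset H ` A"
      and LP: "\<forall>\<^sub>F n in sequentially. left_coset H (L n) \<in> P"
      using cs[unfolded cs_network_def, THEN conjunct2, rule_format,
          of "left_coset H x" "left_coset H \<circ> L" "left_coset H ` A"]
      unfolding o_apply by blast
    \<comment> \<open>Closeness of \<open>b\<close> to \<open>x\<close> is needed in two forms: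
      \<open>gyrominus b\<close> plus \<open>x\<close> in \<open>U0\<close> puts \<open>x\<close>
      into \<open>N P b U\<close>, and \<open>b\<close> in \<open>A\<close> makes \<open>t\<close>
      an element of \<open>U\<close>.\<close>
    define C where "C = {y \<in> topspace X. gyrominus y \<oplus>\<^sub>g x \<in> U0} \<inter> A"
    have "openin X C" "x \<in> C"
      using openin_minus_plus[OF x U0(1)] A x U0(2) by (auto simp: C_def minus_plus)
    then obtain b where b: "b \<in> B P" "b \<in> C"
      using B_dense[OF P(1) _ _ P(2)] by blast
    have bX: "b \<in> topspace X"
      using b(1) BX P(1) by blast
    have bx: "gyrominus b \<oplus>\<^sub>g x \<in> U0"
      using b(2) by (simp add: C_def)
    have "N P b U \<subseteq> S"
    proof
      fix y assume "y \<in> N P b U"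
      then have y: "y \<in> topspace X" "gyrominus b \<oplus>\<^sub>g y \<in> U" "left_coset H y \<in> P"
        by (auto simp: N_def)
      define t where "t = gyrominus x \<oplus>\<^sub>g b"
      have t: "t \<in> U" "b = x \<oplus>\<^sub>g t"
        using b(2) U0(3) bX x by (auto simp: t_def C_def A_def plus_minus_cancel)
      have tX: "t \<in> topspace X"
        using t UX by blast
      \<comment> \<open>First route from \<open>x\<close> to \<open>y\<close>, through
        \<open>b\<close>; invariance of \<open>U\<close> keeps the rebracketed summand
        \<open>v\<close> in \<open>U\<close>.\<close>
      have "y = (x \<oplus>\<^sub>g t) \<oplus>\<^sub>g (gyrominus b \<oplus>\<^sub>g y)"
        using t(2) plus_minus_cancel[OF bX y(1)] by simp
      then obtain v where v: "v \<in> U" "y = x \<oplus>\<^sub>g (t \<oplus>\<^sub>g v)"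
        using plus_assoc_gyr_invariant[OF x tX UX U_gyr[OF U x tX] y(2)] by metis
      \<comment> \<open>Second route, through a point \<open>a\<close> of \<open>A\<close> in the
        coset of \<open>y\<close>; invariance of \<open>H\<close> keeps the rebracketed summand
        \<open>h\<close> in \<open>H\<close>.\<close>
      obtain a where a: "a \<in> A" "left_coset H y = left_coset H a"
        using y(3) P(3) by blast
      define w where "w = gyrominus x \<oplus>\<^sub>g a"
      have aX: "a \<in> topspace X"
        using a(1) by (simp add: A_def)
      have w: "w \<in> U" "w \<in> W1" "a = x \<oplus>\<^sub>g w"
        using a(1) aX U0(3) x by (auto simp: w_def A_def plus_minus_cancel)
      have wX: "w \<in> topspace X"
        using w UX by blast
      obtain h' where h': "h' \<in> H" "y = a \<oplus>\<^sub>g h'"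
        using left_coset_eqD[OF H aX y(1) a(2)] by blast
      then obtain h where h: "h \<in> H" "y = x \<oplus>\<^sub>g (w \<oplus>\<^sub>g h)"
        using plus_assoc_gyr_invariant[OF x wX HX strong_subgyrogroup_gyr[OF H x wX] h'(1)] w(3)
        by metis
      have hX: "h \<in> topspace X" and vX: "v \<in> topspace X"
        using h(1) HX v(1) UX by auto
      \<comment> \<open>Cancelling \<open>x\<close> from the two routes expresses \<open>h\<close>
        by \<open>w\<close>, \<open>t\<close> and \<open>v\<close>, so the choice of
        \<open>U\<close> forces \<open>h\<close> into \<open>W1\<close>.\<close>
      have eq: "t \<oplus>\<^sub>g v = w \<oplus>\<^sub>g h"
        using plus_left_cancel[OF x, of "t \<oplus>\<^sub>g v" "w \<oplus>\<^sub>g h"] v(2) h(2) tX vX wX hX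
        by (simp add: plus_closed)
      then have "gyrominus w \<oplus>\<^sub>g (t \<oplus>\<^sub>g v) = h"
        using minus_plus_cancel[OF wX hX] by simp
      then have "h \<in> W1"
        using U_W1[OF w(1) t(1) v(1)] h(1) by simp
      then have "w \<oplus>\<^sub>g h \<in> W"
        using W1(3) w(2) by blast
      then show "y \<in> S"
        using h(2) S0(3) by (auto simp: W_def)
    qed
    moreover have "x \<in> N P b U"
      using x bx U0(3) P(2) by (auto simp: N_def)
    moreover have "\<forall>\<^sub>F n in sequentially. L n \<in> N P b U"
    proof -
      let ?E = "{y \<in> topspace X. gyrominus b \<oplus>\<^sub>g y \<in> U0}"
      have "openin X ?E" "x \<in> ?E"
        using openin_left_translation[OF minus_closed[OF bX] U0(1)] x bx by auto
      then have "\<forall>\<^sub>F n in sequentially. L n \<in> ?E"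
        using Lx unfolding limitin_def by blast
      with LP show ?thesis
        by eventually_elim (use U0(3) in \<open>auto simp: N_def\<close>)
    qed
    moreover have "N P b U \<in> (\<Union>P\<in>\<P>. F P)"
      using P(1) b(1) U unfolding F_def by auto
    ultimately show "\<exists>R\<in>\<Union>P\<in>\<P>. F P. x \<in> R \<and> R \<subseteq> S \<and> (\<forall>\<^sub>F n in sequentially. L n \<in> R)"
      by blast
  qed
  ultimately show ?thesis
    by blast
qed

end

theorem theorem6p10:
  fixes X :: "'a topology"
    and gyroplus :: "'a \<Rightarrow> 'a \<Rightarrow> 'a"
    and zero :: 'a
    and gyrominus :: "'a \<Rightarrow> 'a"
    and gyr :: "'a \<Rightarrow> 'a \<Rightarrow> 'a \<Rightarrow> 'a"
    and H :: "'a set"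
  assumes "strongly_topological_gyrogroup X gyroplus zero gyrominus gyr"
    and "gyrogroup.strong_subgyrogroup (topspace X) gyroplus gyr H"
    and "closedin X H"
    and "first_countable (subtopology X H)"
    and "separable_space (subtopology X H)"
    and "\<exists>\<P>. cs_network (topological_gyrogroup.coset_space X gyroplus H) \<P> \<and> star_countable \<P>"
  shows "\<exists>\<P>. cs_network X \<P> \<and> star_countable \<P>"
proof -
  interpret strongly_topological_gyrogroup X gyroplus zero gyrominus gyr
    by (fact assms(1))
  show ?thesis
    using star_countable_cs_network_lift assms(2,4-6) by blast
qed

end
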